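(* Let $M(n,4)$ denote the maximum cardinality of a family of (undirected) Hamilton paths in the complete graph $K_n$ such that the union of any two distinct members of the family contains a cycle of length four. Then $$\lfloor n/2\rfloor!\;\leq\; M(n,4)\;\leq\; n^{\frac{3n}{4}+O\left(\frac{n}{\log n}\right)}.$$ That is, the lower bound holds for every positive integer $n$, and there is an absolute constant $c>0$ such that $M(n,4)\le n^{\frac{3n}{4}+c\frac{n}{\log n}}$ for all integers $n\ge 2$.
   Context: $K_n$ is the complete graph with vertex set $[n]=\{1,\dots,n\}$. Hamilton paths in $K_n$ are undirected and regarded as subgraphs, so a path and its reversal are the same. The union of two graphs on the same vertex set is the graph on that vertex set whose edge set is the union of the two edge sets. There is no restriction on how the edges of the 4-cycle are distributed between the two paths. *)

theory Defs
  imports Complex_Main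
begin

text \<open>Finite simple undirected graphs on natural numbers, as pairs of a vertex set and a set of
  edges; an edge is a two-element set of vertices.\<close>

type_synonym ugraph = "nat set \<times> nat set set"

abbreviation verts :: "ugraph \<Rightarrow> nat set" where
  "verts \<equiv> fst"

abbreviation edges :: "ugraph \<Rightarrow> nat set set" where
  "edges \<equiv> snd"

definition subgraph :: "ugraph \<Rightarrow> ugraph \<Rightarrow> bool" where
  "subgraph H G \<longleftrightarrow> verts H \<subseteq> verts G \<and> edges H \<subseteq> edges G"

definition graph_union :: "ugraph \<Rightarrow> ugraph \<Rightarrow> ugraph" where
  "graph_union G H = (verts G \<union> verts H, edges G \<union> edges H)"

definition complete_graph :: "nat \<Rightarrow> ugraph" where
  "complete_graph n = ({1..n}, {{u, v} |u v. u \<in> {1..n} \<and> v \<in> {1..n} \<and> u \<noteq> v})"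

text \<open>The list is only a traversal of the path: a list and its reversal yield the same graph,
  so paths are undirected.\<close>

definition path_graph :: "nat list \<Rightarrow> ugraph" where
  "path_graph vs = (set vs, {{vs ! i, vs ! Suc i} |i. Suc i < length vs})"

definition cycle_graph :: "nat list \<Rightarrow> ugraph" where
  "cycle_graph vs = (set vs, {{vs ! i, vs ! (Suc i mod length vs)} |i. i < length vs})"

definition hamilton_path :: "ugraph \<Rightarrow> ugraph \<Rightarrow> bool" where
  "hamilton_path G P \<longleftrightarrow>
    (\<exists>vs. vs \<noteq> [] \<and> distinct vs \<and> P = path_graph vs \<and> verts P = verts G \<and> subgraph P G)"

definition contains_cycle :: "nat \<Rightarrow> ugraph \<Rightarrow> bool" where
  "contains_cycle k G \<longleftrightarrow>
    3 \<le> k \<and> (\<exists>vs. distinct vs \<and> length vs = k \<and> subgraph (cycle_graph vs) G)"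

definition cycle_families :: "nat \<Rightarrow> nat \<Rightarrow> ugraph set set" where
  "cycle_families n k =
    {F. F \<subseteq> {P. hamilton_path (complete_graph n) P} \<and>
        pairwise (\<lambda>P Q. contains_cycle k (graph_union P Q)) F}"

definition M :: "nat \<Rightarrow> nat \<Rightarrow> nat" where
  "M n k = Max (card ` cycle_families n k)"

text \<open>The maximum defining \<open>M\<close> is attained, and every family it ranges over is finite.\<close>

lemma finite_hamilton_paths: "finite {P. hamilton_path (complete_graph n) P}"
proof (rule finite_subset)
  show "{P. hamilton_path (complete_graph n) P} \<subseteq> {{1..n}} \<times> Pow (Pow {1..n})"
    by (force simp: hamilton_path_def complete_graph_def subgraph_def)
qed simp

lemma finite_cycle_families: "finite (cycle_families n k)"
  unfolding cycle_families_def
  by (rule finite_subset[of _ "Pow {P. hamilton_path (complete_graph n) P}"])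
     (auto simp: finite_hamilton_paths)

lemma cycle_family_finite: "F \<in> cycle_families n k \<Longrightarrow> finite F"
  unfolding cycle_families_def using finite_hamilton_paths finite_subset by blast

lemma M_attained: "\<exists>F \<in> cycle_families n k. card F = M n k"
proof -
  have "{} \<in> cycle_families n k"
    by (simp add: cycle_families_def pairwise_def)
  then have "Max (card ` cycle_families n k) \<in> card ` cycle_families n k"
    by (intro Max_in) (auto simp: finite_cycle_families)
  then show ?thesis
    by (auto simp: M_def)
qed

lemma card_le_M: "F \<in> cycle_families n k \<Longrightarrow> card F \<le> M n k"
  unfolding M_def by (intro Max_ge) (auto simp: finite_cycle_families)

end

theory Submission
  imports Defs "HOL-Combinatorics.Permutations"
begin

text \<open>
  Lower bound. Let \<open>m = n div 2\<close>. Fix \<open>n - m\<close> vertices \<open>a\<^sub>0, a\<^sub>1, \<dots>\<close> in this order and insert the other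
  \<open>m\<close> vertices, permuted by \<open>\<sigma>\<close>, into the gaps. If \<open>\<sigma>\<close> and \<open>\<tau>\<close> differ at a gap between \<open>a\<^sub>i\<close> and
  its successor, then one path joins these two vertices through one middle vertex, the other path
  through another one, and together they form a four-cycle. Two permutations differ in at least
  two places, so they differ at a gap that has a vertex on both sides. Since a single path has no
  four-cycle, the same argument shows that different permutations give different paths.

  Upper bound. Let \<open>F\<close> be a family of Hamilton paths whose pairwise unions contain four-cycles. A
  graph without four-cycles has at most one member of \<open>F\<close> as a subgraph. Hence, for a random graph
  \<open>G\<close> on \<open>{1..n}\<close> in which each edge occurs independently with probability \<open>p\<close>, the events
  ``\<open>P\<close> is contained in \<open>G\<close>, and \<open>G\<close> has no four-cycle'' for \<open>P \<in> F\<close> are disjoint, and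
  \<open>card F\<close> is at most the reciprocal of the smallest of their probabilities
  (\<open>card_cycle_family_le\<close>).

  Such a probability is at least \<open>p ^ n\<close> times the probability that the random edges outside \<open>P\<close>
  complete no four-cycle. Absence of a set of edges is a decreasing event, decreasing events are
  positively correlated, and so the latter probability is at least the product of
  \<open>1 - p ^ k\<close> over the possible four-cycles, with \<open>k\<close> the number of edges of the cycle outside
  \<open>P\<close> (\<open>avoidance_correlation\<close>). As \<open>P\<close> is acyclic, \<open>k \<ge> 1\<close>. Opening a cycle at an edge outside
  \<open>P\<close> leaves a walk of three steps, where a step costs \<open>1\<close> along \<open>P\<close> and \<open>p\<close> elsewhere; the steps from one
  vertex cost at most \<open>n * p + 2\<close> in total, so the numbers \<open>p ^ k\<close> sum to at most
  \<open>n * p * (n * p + 2) ^ 3\<close>. With \<open>p\<close> of order \<open>n powr (-3/4)\<close> this is linear in \<open>n\<close>, and the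
  probability is \<open>n powr (-3 * n / 4)\<close> up to a factor exponential in \<open>n\<close>. Such a factor
  is \<open>n\<close> to a power of order \<open>n / ln n\<close>.
\<close>

section \<open>Four-cycles and paths\<close>

lemma contains_four_cycle_iff:
  "contains_cycle 4 G \<longleftrightarrow>
    (\<exists>a b c d. distinct [a, b, c, d] \<and> {a, b, c, d} \<subseteq> verts G \<and>
      {{a, b}, {b, c}, {c, d}, {d, a}} \<subseteq> edges G)"
proof -
  have edges_eq: "edges (cycle_graph [a, b, c, d]) = {{a, b}, {b, c}, {c, d}, {d, a}}" for a b c d
  proof -
    have "{i. i < (4::nat)} = {0, 1, 2, 3}" by auto
    moreover have "edges (cycle_graph [a, b, c, d]) =
        (\<lambda>i. {[a, b, c, d] ! i, [a, b, c, d] ! (Suc i mod 4)}) ` {i. i < (4::nat)}"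
      by (auto simp: cycle_graph_def)
    ultimately show ?thesis by simp
  qed
  have verts_eq: "verts (cycle_graph vs) = set vs" for vs
    by (simp add: cycle_graph_def)
  have len4: "length vs = 4 \<longleftrightarrow> (\<exists>a b c d. vs = [a, b, c, d])" for vs :: "nat list"
    by (simp add: length_Suc_conv numeral_eq_Suc) blast
  show ?thesis
    unfolding contains_cycle_def subgraph_def
  proof (intro iffI; elim conjE exE)
    fix vs :: "nat list"
    assume d: "distinct vs" and l: "length vs = 4"
      and s: "verts (cycle_graph vs) \<subseteq> verts G" "edges (cycle_graph vs) \<subseteq> edges G"
    from l obtain a b c d where "vs = [a, b, c, d]" unfolding len4 by blast
    with d s edges_eq[of a b c d] verts_eq[of vs]
    show "\<exists>a b c d. distinct [a, b, c, d] \<and> {a, b, c, d} \<subseteq> verts G \<and>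
      {{a, b}, {b, c}, {c, d}, {d, a}} \<subseteq> edges G"
      by (intro exI[of _ a] exI[of _ b] exI[of _ c] exI[of _ d]) simp
  next
    fix a b c d
    assume "distinct [a, b, c, d]" "{a, b, c, d} \<subseteq> verts G"
      "{{a, b}, {b, c}, {c, d}, {d, a}} \<subseteq> edges G"
    then show "3 \<le> (4::nat) \<and> (\<exists>vs. distinct vs \<and> length vs = 4 \<and>
      verts (cycle_graph vs) \<subseteq> verts G \<and> edges (cycle_graph vs) \<subseteq> edges G)"
      using edges_eq[of a b c d] verts_eq[of "[a, b, c, d]"]
      by (intro conjI exI[of _ "[a, b, c, d]"]) simp_all
  qed
qed

lemma contains_four_cycleE:
  assumes "contains_cycle 4 G"
  obtains a b c d where "distinct [a, b, c, d]" "{a, b, c, d} \<subseteq> verts G"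
    "{{a, b}, {b, c}, {c, d}, {d, a}} \<subseteq> edges G"
  using assms unfolding contains_four_cycle_iff by (elim exE conjE)

lemma contains_four_cycleI:
  assumes "distinct [a, b, c, d]" "{a, b, c, d} \<subseteq> verts G"
    "{{a, b}, {b, c}, {c, d}, {d, a}} \<subseteq> edges G"
  shows "contains_cycle 4 G"
  unfolding contains_four_cycle_iff using assms by (intro exI conjI)

lemma contains_four_cycle_mono:
  "contains_cycle 4 G \<Longrightarrow> verts G \<subseteq> verts H \<Longrightarrow> edges G \<subseteq> edges H \<Longrightarrow> contains_cycle 4 H"
  by (elim contains_four_cycleE, rule contains_four_cycleI) (assumption | erule (1) order_trans)+

lemma verts_path_graph [simp]: "verts (path_graph vs) = set vs"
  by (simp add: path_graph_def)

text \<open>Adjacency in a path becomes arithmetic on positions, which is how degrees and cycles of paths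
  are handled below.\<close>

lemma edge_path_graph_iff:
  assumes "distinct vs" "i < length vs" "j < length vs"
  shows "{vs ! i, vs ! j} \<in> edges (path_graph vs) \<longleftrightarrow> j = Suc i \<or> i = Suc j"
proof
  assume "{vs ! i, vs ! j} \<in> edges (path_graph vs)"
  then obtain k where "{vs ! i, vs ! j} = {vs ! k, vs ! Suc k}" "Suc k < length vs"
    by (auto simp: path_graph_def)
  then show "j = Suc i \<or> i = Suc j"
    using assms by (auto simp: doubleton_eq_iff nth_eq_iff_index_eq)
next
  assume "j = Suc i \<or> i = Suc j"
  then show "{vs ! i, vs ! j} \<in> edges (path_graph vs)"
    using assms unfolding path_graph_def by (auto simp: doubleton_eq_iff)
qed

text \<open>The two neighbours of a position \<open>j\<close> are \<open>j - 1\<close> and \<open>j + 1\<close>, and no position except \<open>j\<close> is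
  adjacent to both; so opposite corners of a four-cycle would coincide.\<close>

lemma path_graph_no_four_cycle:
  assumes "distinct vs"
  shows "\<not> contains_cycle 4 (path_graph vs)"
proof
  assume "contains_cycle 4 (path_graph vs)"
  then obtain a b c d where dist: "distinct [a, b, c, d]"
    and sub: "{a, b, c, d} \<subseteq> set vs"
      "{{a, b}, {b, c}, {c, d}, {d, a}} \<subseteq> edges (path_graph vs)"
    unfolding verts_path_graph[symmetric] by (rule contains_four_cycleE)
  from sub(1) obtain i j k l where ix: "i < length vs" "j < length vs" "k < length vs" "l < length vs"
    "a = vs ! i" "b = vs ! j" "c = vs ! k" "d = vs ! l"
    by (auto simp: in_set_conv_nth)
  have "distinct [i, j, k, l]" using dist ix by auto
  moreover have "j = Suc i \<or> i = Suc j" "k = Suc j \<or> j = Suc k"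
    "l = Suc k \<or> k = Suc l" "i = Suc l \<or> l = Suc i"
    using sub(2) ix edge_path_graph_iff[OF assms] by auto
  ultimately show False by auto
qed

lemma hamilton_path_complete_graphE:
  assumes "hamilton_path (complete_graph n) P"
  obtains vs where "distinct vs" "set vs = {1..n}" "length vs = n" "P = path_graph vs"
    "edges P \<subseteq> edges (complete_graph n)"
proof -
  from assms obtain vs where vs: "distinct vs" "P = path_graph vs"
      "verts P = {1..n}" "edges P \<subseteq> edges (complete_graph n)"
    unfolding hamilton_path_def subgraph_def by (auto simp: complete_graph_def)
  then have "set vs = {1..n}" by (simp add: path_graph_def)
  moreover from this have "length vs = n" using distinct_card[OF vs(1)] by simp
  ultimately show ?thesis using that vs by blast
qed

section \<open>The lower bound: fixed odd positions, permuted even positions\<close>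

text \<open>Positions count from \<open>0\<close>: even positions hold \<open>1, \<dots>, n - n div 2\<close> in increasing order, odd
  positions the larger vertices permuted by \<open>\<sigma>\<close>.\<close>

definition interleaving :: "nat \<Rightarrow> (nat \<Rightarrow> nat) \<Rightarrow> nat list" where
  "interleaving n \<sigma> =
    map (\<lambda>t. if even t then Suc (t div 2) else Suc (n - n div 2 + \<sigma> (t div 2))) [0..<n]"

lemma length_interleaving [simp]: "length (interleaving n \<sigma>) = n"
  by (simp add: interleaving_def)

lemma nth_interleaving_even: "2 * i < n \<Longrightarrow> interleaving n \<sigma> ! (2 * i) = Suc i"
  by (simp add: interleaving_def)

lemma nth_interleaving_odd:
  "Suc (2 * i) < n \<Longrightarrow> interleaving n \<sigma> ! Suc (2 * i) = Suc (n - n div 2 + \<sigma> i)"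
  by (simp add: interleaving_def)

lemma interleaving_distinct:
  assumes "\<sigma> permutes {..<n div 2}"
  shows "distinct (interleaving n \<sigma>)"
proof -
  have inj: "\<sigma> x = \<sigma> y \<Longrightarrow> x = y" for x y
    using permutes_inj[OF assms] by (auto dest: injD)
  show ?thesis
    unfolding interleaving_def distinct_map
  proof (intro conjI inj_onI)
    fix s t assume s: "s \<in> set [0..<n]" and t: "t \<in> set [0..<n]"
      and eq: "(if even s then Suc (s div 2) else Suc (n - n div 2 + \<sigma> (s div 2))) =
        (if even t then Suc (t div 2) else Suc (n - n div 2 + \<sigma> (t div 2)))"
    have small: "even r \<Longrightarrow> r < n \<Longrightarrow> r div 2 < n - n div 2" for r by presburger
    consider "even s" "even t" | "odd s" "odd t" | "even s" "odd t" | "odd s" "even t" by blast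
    then show "s = t"
    proof cases
      case 1 then show ?thesis using eq by (auto elim!: evenE)
    next
      case 2 then show ?thesis using eq inj[of "s div 2" "t div 2"] by (auto elim!: oddE)
    next
      case 3 then show ?thesis using eq small[of s] s by auto
    next
      case 4 then show ?thesis using eq small[of t] t by auto
    qed
  qed simp
qed

lemma interleaving_set:
  assumes "\<sigma> permutes {..<n div 2}"
  shows "set (interleaving n \<sigma>) = {1..n}"
proof (rule card_subset_eq)
  show "set (interleaving n \<sigma>) \<subseteq> {1..n}"
  proof
    fix x assume "x \<in> set (interleaving n \<sigma>)"
    then obtain t where t: "t < n"
      "x = (if even t then Suc (t div 2) else Suc (n - n div 2 + \<sigma> (t div 2)))"
      by (auto simp: interleaving_def)
    show "x \<in> {1..n}"
    proof (cases "even t")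
      case True then show ?thesis using t by auto
    next
      case False
      then have "t div 2 < n div 2" using t(1) by presburger
      then have "\<sigma> (t div 2) < n div 2" using permutes_in_image[OF assms] by auto
      then show ?thesis using t False by auto
    qed
  qed
  show "card (set (interleaving n \<sigma>)) = card {1..n}"
    using distinct_card[OF interleaving_distinct[OF assms]] by simp
qed simp

lemma interleaving_hamilton_path:
  assumes "1 \<le> n" "\<sigma> permutes {..<n div 2}"
  shows "hamilton_path (complete_graph n) (path_graph (interleaving n \<sigma>))"
proof -
  let ?vs = "interleaving n \<sigma>"
  have "{?vs ! i, ?vs ! Suc i} \<in> edges (complete_graph n)" if "Suc i < n" for i
  proof -
    have "?vs ! i \<in> {1..n}" "?vs ! Suc i \<in> {1..n}"
      using that interleaving_set[OF assms(2)] nth_mem[of _ ?vs] by auto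
    moreover have "?vs ! i \<noteq> ?vs ! Suc i"
      using that interleaving_distinct[OF assms(2)] by (simp add: nth_eq_iff_index_eq)
    ultimately show ?thesis unfolding complete_graph_def by auto
  qed
  then have "edges (path_graph ?vs) \<subseteq> edges (complete_graph n)"
    by (auto simp: path_graph_def)
  then show ?thesis
    unfolding hamilton_path_def subgraph_def
    using assms interleaving_distinct[OF assms(2)] interleaving_set[OF assms(2)]
    by (intro exI[of _ ?vs]) (auto simp: path_graph_def complete_graph_def interleaving_def)
qed

lemma interleaving_union_four_cycle:
  assumes \<sigma>: "\<sigma> permutes {..<n div 2}" and \<tau>: "\<tau> permutes {..<n div 2}" and "\<sigma> \<noteq> \<tau>"
  shows "contains_cycle 4
    (graph_union (path_graph (interleaving n \<sigma>)) (path_graph (interleaving n \<tau>)))"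
    (is "contains_cycle 4 (graph_union ?P ?Q)")
proof -
  \<comment> \<open>If \<open>n\<close> is even, the last gap has no fixed vertex on its right, so a disagreement elsewhere is
    needed.\<close>
  have differ_twice: "\<exists>i'. i' \<noteq> i \<and> \<sigma> i' \<noteq> \<tau> i'" if "\<sigma> i \<noteq> \<tau> i" for i
  proof -
    obtain i' where "\<sigma> i' = \<tau> i" using permutes_surj[OF \<sigma>] by (metis surjD)
    then show ?thesis using that permutes_inj[OF \<tau>] by (metis injD)
  qed
  obtain i where i: "\<sigma> i \<noteq> \<tau> i" "i \<noteq> n div 2 - 1"
    using assms(3) differ_twice by (metis ext)
  have "i < n div 2"
    using i(1) permutes_not_in[OF \<sigma>, of i] permutes_not_in[OF \<tau>, of i] by fastforce
  with i(2) have "Suc i < n div 2" by linarith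
  then have lt: "2 * Suc i < n" by presburger
  define x y where "x = Suc (n - n div 2 + \<sigma> i)" and "y = Suc (n - n div 2 + \<tau> i)"
  have edge: "{Suc i, Suc (n - n div 2 + \<rho> i)} \<in> edges (path_graph (interleaving n \<rho>))"
    "{Suc (n - n div 2 + \<rho> i), Suc (Suc i)} \<in> edges (path_graph (interleaving n \<rho>))"
    "Suc (n - n div 2 + \<rho> i) \<in> set (interleaving n \<rho>)" for \<rho>
  proof -
    let ?v = "interleaving n \<rho>"
    have v: "?v ! (2 * i) = Suc i" "?v ! Suc (2 * i) = Suc (n - n div 2 + \<rho> i)"
      "?v ! Suc (Suc (2 * i)) = Suc (Suc i)"
      using lt nth_interleaving_even[of i n \<rho>] nth_interleaving_even[of "Suc i" n \<rho>]
        nth_interleaving_odd[of i n \<rho>] by simp_all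
    show "{Suc i, Suc (n - n div 2 + \<rho> i)} \<in> edges (path_graph ?v)"
      using v lt unfolding path_graph_def
      by (simp, intro exI[of _ "2 * i"]) simp
    show "{Suc (n - n div 2 + \<rho> i), Suc (Suc i)} \<in> edges (path_graph ?v)"
      using v lt unfolding path_graph_def
      by (simp, intro exI[of _ "Suc (2 * i)"]) simp
    show "Suc (n - n div 2 + \<rho> i) \<in> set ?v"
      using v(2) lt nth_mem[of "Suc (2 * i)" ?v] by simp
  qed
  have "distinct [Suc i, x, Suc (Suc i), y]"
    using i(1) lt by (auto simp: x_def y_def)
  moreover have "{Suc i, x, Suc (Suc i), y} \<subseteq> verts (graph_union ?P ?Q)"
    using lt edge(3)[of \<sigma>] edge(3)[of \<tau>]
    by (simp add: graph_union_def x_def y_def interleaving_set[OF \<sigma>])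
  moreover have "{{Suc i, x}, {x, Suc (Suc i)}} \<subseteq> edges ?P"
    using edge[of \<sigma>] by (simp add: x_def)
  moreover have "{{Suc (Suc i), y}, {y, Suc i}} \<subseteq> edges ?Q"
    using edge[of \<tau>] unfolding y_def
    by (simp add: insert_commute[of "Suc (Suc i)"] insert_commute[of _ "Suc i"])
  ultimately show ?thesis
    by (intro contains_four_cycleI[of "Suc i" x "Suc (Suc i)" y]) (simp_all add: graph_union_def)
qed

text \<open>Distinctness of the paths comes for free: if two permutations gave the same path, its union
  with itself would be a path with a four-cycle.\<close>

lemma fact_half_le_M:
  assumes "1 \<le> n"
  shows "fact (n div 2) \<le> M n 4"
proof -
  define S where "S = {\<sigma>. \<sigma> permutes {..<n div 2}}"
  define p where "p = (\<lambda>\<sigma>. path_graph (interleaving n \<sigma>))"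
  have "inj_on p S"
  proof (rule inj_onI, rule ccontr)
    fix \<sigma> \<tau> assume *: "\<sigma> \<in> S" "\<tau> \<in> S" "p \<sigma> = p \<tau>" "\<sigma> \<noteq> \<tau>"
    then have "contains_cycle 4 (graph_union (p \<sigma>) (p \<sigma>))"
      using interleaving_union_four_cycle[of \<sigma> n \<tau>] by (simp add: S_def p_def)
    moreover have "graph_union (p \<sigma>) (p \<sigma>) = p \<sigma>" by (simp add: graph_union_def)
    ultimately show False
      using * path_graph_no_four_cycle[OF interleaving_distinct, of \<sigma> n]
      by (simp add: S_def p_def)
  qed
  moreover have "card S = fact (n div 2)"
    unfolding S_def by (rule card_permutations) simp_all
  ultimately have "card (p ` S) = fact (n div 2)"
    by (simp add: card_image)
  moreover have "p ` S \<in> cycle_families n 4"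
  proof -
    have "hamilton_path (complete_graph n) (p \<sigma>)" if "\<sigma> \<in> S" for \<sigma>
      using interleaving_hamilton_path[OF assms] that by (simp add: S_def p_def)
    moreover have "contains_cycle 4 (graph_union (p \<sigma>) (p \<tau>))"
      if "\<sigma> \<in> S" "\<tau> \<in> S" "p \<sigma> \<noteq> p \<tau>" for \<sigma> \<tau>
      using interleaving_union_four_cycle[of \<sigma> n \<tau>] that by (force simp: S_def p_def)
    ultimately show ?thesis
      unfolding cycle_families_def pairwise_def by blast
  qed
  ultimately show ?thesis using card_le_M[of "p ` S" n 4] by simp
qed

section \<open>Random subsets and a correlation inequality\<close>

text \<open>The probability of the outcome \<open>G\<close> when each element of \<open>U\<close> is selected independently with
  probability \<open>p\<close>; probabilities of events are finite sums of these weights.\<close>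

definition bernoulli_weight :: "real \<Rightarrow> 'a set \<Rightarrow> 'a set \<Rightarrow> real" where
  "bernoulli_weight p U G = p ^ card G * (1 - p) ^ card (U - G)"

lemma bernoulli_weight_nonneg: "0 \<le> p \<Longrightarrow> p \<le> 1 \<Longrightarrow> 0 \<le> bernoulli_weight p U G"
  by (simp add: bernoulli_weight_def)

text \<open>Conditioning on whether \<open>u\<close> is selected; all inductions on the ground set go through this.\<close>

lemma sum_bernoulli_weight_insert:
  assumes "finite U" "u \<notin> U"
  shows "(\<Sum>G\<in>Pow (insert u U). bernoulli_weight p (insert u U) G * f G) =
    p * (\<Sum>G\<in>Pow U. bernoulli_weight p U G * f (insert u G)) +
    (1 - p) * (\<Sum>G\<in>Pow U. bernoulli_weight p U G * f G)"
proof -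
  have inj: "inj_on (insert u) (Pow U)"
    using assms(2) by (intro inj_onI) (metis PowD in_mono insert_ident)
  have disj: "Pow U \<inter> insert u ` Pow U = {}"
    using assms(2) by blast
  have with_u: "bernoulli_weight p (insert u U) (insert u G) = p * bernoulli_weight p U G"
    if "G \<in> Pow U" for G
  proof -
    have "finite G" "u \<notin> G" using that assms finite_subset by auto
    moreover have "insert u U - insert u G = U - G" using assms(2) by auto
    ultimately show ?thesis by (simp add: bernoulli_weight_def)
  qed
  have without_u: "bernoulli_weight p (insert u U) G = (1 - p) * bernoulli_weight p U G"
    if "G \<in> Pow U" for G
  proof -
    have "insert u U - G = insert u (U - G)" using that assms(2) by auto
    then show ?thesis using assms by (simp add: bernoulli_weight_def)
  qed
  show ?thesis
    unfolding Pow_insert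
    by (subst sum.union_disjoint)
       (use assms disj in \<open>auto simp: sum.reindex[OF inj] with_u without_u sum_distrib_left mult.assoc\<close>)
qed

lemma sum_bernoulli_weight:
  assumes "finite U"
  shows "(\<Sum>G\<in>Pow U. bernoulli_weight p U G) = 1"
  using assms
proof (induction U rule: finite_induct)
  case empty
  then show ?case by (simp add: bernoulli_weight_def)
next
  case (insert u U)
  then show ?case
    using sum_bernoulli_weight_insert[of U u p "\<lambda>_. 1"] by simp
qed

text \<open>Positive correlation for a single coin: each \<open>1 - x * t j\<close> is decreasing in \<open>x \<in> {0, 1}\<close>, so
  the mean of their product under a coin of bias \<open>p\<close> is at least the product of their means.\<close>

lemma prod_le_two_point_average:
  fixes p :: real
  assumes "finite J" "0 \<le> p" "p \<le> 1" "\<And>j. j \<in> J \<Longrightarrow> 0 \<le> t j \<and> t j \<le> 1"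
  shows "(\<Prod>j\<in>J. 1 - p * t j) \<le> p * (\<Prod>j\<in>J. 1 - t j) + (1 - p)"
  using assms(1,4)
proof (induction J rule: finite_induct)
  case (insert k J)
  define X where "X = (\<Prod>j\<in>J. 1 - t j)"
  have X: "X \<le> 1" unfolding X_def
    using insert.prems by (intro prod_le_1) auto
  have t: "0 \<le> t k" "t k \<le> 1" using insert.prems by auto
  have "p * t k \<le> 1" using t assms by (simp add: mult_le_one)
  moreover have "(\<Prod>j\<in>J. 1 - p * t j) \<le> p * X + (1 - p)"
    using insert unfolding X_def by auto
  ultimately have "(1 - p * t k) * (\<Prod>j\<in>J. 1 - p * t j) \<le> (1 - p * t k) * (p * X + (1 - p))"
    by (intro mult_left_mono) auto
  also have "\<dots> = p * ((1 - t k) * X) + (1 - p) - (p * t k) * ((1 - p) * (1 - X))"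
    by (simp add: algebra_simps)
  also have "\<dots> \<le> p * ((1 - t k) * X) + (1 - p)"
    using t assms X by simp
  finally show ?case using insert.hyps by (simp add: X_def)
qed simp

text \<open>An instance of Harris' inequality, for the decreasing events that \<open>S j\<close> is not contained in
  the random set \<open>G\<close>. The sets \<open>S j\<close> may repeat. In the induction step, the coin for \<open>u\<close> is
  tossed: if \<open>u\<close> is selected, every \<open>S j\<close> loses it; if not, the sets that contain \<open>u\<close> are avoided
  anyway. The factors of these sets are then recombined by the single-coin inequality.\<close>

lemma avoidance_correlation:
  fixes S :: "'j \<Rightarrow> 'a set" and p :: real
  assumes "finite U" "finite J" "\<And>j. j \<in> J \<Longrightarrow> S j \<subseteq> U" "0 \<le> p" "p \<le> 1"
  shows "(\<Prod>j\<in>J. 1 - p ^ card (S j)) \<le>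
    (\<Sum>G\<in>Pow U. bernoulli_weight p U G * of_bool (\<forall>j\<in>J. \<not> S j \<subseteq> G))"
  using assms(1-3)
proof (induction U arbitrary: J S rule: finite_induct)
  case empty
  then show ?case
    by (cases "J = {}") (auto simp: bernoulli_weight_def power_0_left)
next
  case (insert u U)
  define J0 where "J0 = {j \<in> J. u \<notin> S j}"
  define J1 where "J1 = {j \<in> J. u \<in> S j}"
  define T where "T j = S j - {u}" for j
  have J: "J = J0 \<union> J1" "J0 \<inter> J1 = {}" "finite J0" "finite J1"
    using insert.prems by (auto simp: J0_def J1_def)
  have split_prod: "prod h J = prod h J0 * prod h J1" for h :: "'j \<Rightarrow> real"
    using J by (simp add: prod.union_disjoint)
  have card_S: "p ^ card (S j) = p * p ^ card (T j)" if "j \<in> J1" for j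
  proof -
    have "finite (S j)" using that insert.prems(2)[of j] insert.hyps(1)
      by (auto simp: J1_def intro: finite_subset)
    then have "card (S j) = Suc (card (T j))"
      using that card.remove[of "S j" u] by (simp add: T_def J1_def)
    then show ?thesis by simp
  qed
  have pow: "0 \<le> p ^ k \<and> p ^ k \<le> 1" for k
    using assms(4,5) by (simp add: power_le_one)
  have cov1: "(\<Prod>j\<in>J. 1 - p ^ card (T j)) \<le>
      (\<Sum>G\<in>Pow U. bernoulli_weight p U G * of_bool (\<forall>j\<in>J. \<not> T j \<subseteq> G))"
    by (rule insert.IH) (use insert.prems in \<open>auto simp: T_def\<close>)
  have cov0: "(\<Prod>j\<in>J0. 1 - p ^ card (S j)) \<le>
      (\<Sum>G\<in>Pow U. bernoulli_weight p U G * of_bool (\<forall>j\<in>J0. \<not> S j \<subseteq> G))"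
    by (rule insert.IH) (use insert.prems in \<open>auto simp: J0_def\<close>)
  have T0: "T j = S j" if "j \<in> J0" for j using that by (auto simp: T_def J0_def)
  have "(\<Prod>j\<in>J. 1 - p ^ card (S j)) =
      (\<Prod>j\<in>J0. 1 - p ^ card (S j)) * (\<Prod>j\<in>J1. 1 - p * p ^ card (T j))"
    by (simp add: split_prod card_S)
  also have "\<dots> \<le> (\<Prod>j\<in>J0. 1 - p ^ card (S j)) * (p * (\<Prod>j\<in>J1. 1 - p ^ card (T j)) + (1 - p))"
    using J assms(4,5) pow
    by (intro mult_left_mono prod_le_two_point_average prod_nonneg) auto
  also have "\<dots> = p * (\<Prod>j\<in>J. 1 - p ^ card (T j)) + (1 - p) * (\<Prod>j\<in>J0. 1 - p ^ card (S j))"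
    by (simp add: split_prod T0 algebra_simps)
  also have "\<dots> \<le>
      p * (\<Sum>G\<in>Pow U. bernoulli_weight p U G * of_bool (\<forall>j\<in>J. \<not> T j \<subseteq> G)) +
      (1 - p) * (\<Sum>G\<in>Pow U. bernoulli_weight p U G * of_bool (\<forall>j\<in>J0. \<not> S j \<subseteq> G))"
    using cov0 cov1 assms(4,5) by (intro add_mono mult_left_mono) auto
  also have "\<dots> =
      p * (\<Sum>G\<in>Pow U. bernoulli_weight p U G * of_bool (\<forall>j\<in>J. \<not> S j \<subseteq> insert u G)) +
      (1 - p) * (\<Sum>G\<in>Pow U. bernoulli_weight p U G * of_bool (\<forall>j\<in>J. \<not> S j \<subseteq> G))"
  proof -
    have "(\<forall>j\<in>J. \<not> T j \<subseteq> G) \<longleftrightarrow> (\<forall>j\<in>J. \<not> S j \<subseteq> insert u G)" for G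
      unfolding T_def by blast
    moreover have "(\<forall>j\<in>J0. \<not> S j \<subseteq> G) \<longleftrightarrow> (\<forall>j\<in>J. \<not> S j \<subseteq> G)" if "G \<in> Pow U" for G
      using that insert.hyps(2) unfolding J0_def by blast
    ultimately show ?thesis by simp
  qed
  also have "\<dots> = (\<Sum>G\<in>Pow (insert u U).
      bernoulli_weight p (insert u U) G * of_bool (\<forall>j\<in>J. \<not> S j \<subseteq> G))"
    by (rule sum_bernoulli_weight_insert[OF insert.hyps(1,2), symmetric])
  finally show ?case .
qed

text \<open>Conditioned on containing \<open>A\<close>, the random set is \<open>A\<close> together with a random subset of the rest.\<close>

lemma sum_bernoulli_weight_superset:
  assumes "finite U" "A \<subseteq> U"
  shows "(\<Sum>G | G \<subseteq> U \<and> A \<subseteq> G \<and> Q G. bernoulli_weight p U G) =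
    p ^ card A * (\<Sum>H\<in>Pow (U - A). bernoulli_weight p (U - A) H * of_bool (Q (A \<union> H)))"
proof -
  have inj: "inj_on (\<lambda>H. A \<union> H) (Pow (U - A))"
    by (intro inj_onI) blast
  have img: "(\<lambda>H. A \<union> H) ` Pow (U - A) = {G. G \<subseteq> U \<and> A \<subseteq> G}"
  proof (intro equalityI subsetI)
    fix G assume G: "G \<in> {G. G \<subseteq> U \<and> A \<subseteq> G}"
    then have "G = A \<union> (G - A)" "G - A \<in> Pow (U - A)" by auto
    then show "G \<in> (\<lambda>H. A \<union> H) ` Pow (U - A)" by blast
  qed (use assms(2) in auto)
  have weight: "bernoulli_weight p U (A \<union> H) = p ^ card A * bernoulli_weight p (U - A) H"
    if "H \<in> Pow (U - A)" for H
  proof -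
    have "card (A \<union> H) = card A + card H"
      using that assms by (intro card_Un_disjoint) (auto intro: finite_subset)
    moreover have "U - (A \<union> H) = (U - A) - H" by auto
    ultimately show ?thesis by (simp add: bernoulli_weight_def power_add)
  qed
  have "(\<Sum>G | G \<subseteq> U \<and> A \<subseteq> G \<and> Q G. bernoulli_weight p U G) =
      (\<Sum>G | G \<subseteq> U \<and> A \<subseteq> G. bernoulli_weight p U G * of_bool (Q G))"
    using assms(1) by (intro sum.mono_neutral_cong_left) auto
  also have "\<dots> = (\<Sum>H\<in>Pow (U - A). bernoulli_weight p U (A \<union> H) * of_bool (Q (A \<union> H)))"
    unfolding img[symmetric] by (simp add: sum.reindex[OF inj])
  also have "\<dots> = p ^ card A * (\<Sum>H\<in>Pow (U - A). bernoulli_weight p (U - A) H * of_bool (Q (A \<union> H)))"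
    by (simp add: weight sum_distrib_left mult.assoc)
  finally show ?thesis .
qed

section \<open>Four-cycle-free random graphs containing a given path\<close>

text \<open>The probability that a given pair of positions of a path is joined, in the random graph
  conditioned on containing that path.\<close>

definition position_weight :: "real \<Rightarrow> nat \<Rightarrow> nat \<Rightarrow> real" where
  "position_weight p i j = (if j = Suc i \<or> i = Suc j then 1 else p)"

lemma sum_position_weight_le:
  assumes "0 \<le> p"
  shows "(\<Sum>j<n. position_weight p i j) \<le> real n * p + 2"
proof -
  have "(\<Sum>j<n. position_weight p i j) \<le>
      (\<Sum>j<n. p + (of_bool (j = Suc i) + of_bool (Suc j = i)))"
    using assms by (intro sum_mono) (auto simp: position_weight_def)
  also have "\<dots> = real n * p +
      (real (card ({..<n} \<inter> {j. j = Suc i})) + real (card ({..<n} \<inter> {j. Suc j = i})))"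
    by (simp only: sum.distrib sum_of_bool_eq[OF finite_lessThan]) simp
  also have "\<dots> \<le> real n * p + 2"
  proof -
    have "card ({..<n} \<inter> {j. j = Suc i}) \<le> card {Suc i}" by (intro card_mono) auto
    moreover have "card ({..<n} \<inter> {j. Suc j = i}) \<le> card {i - 1}" by (intro card_mono) auto
    ultimately show ?thesis by simp
  qed
  finally show ?thesis .
qed

text \<open>Summing over the end of the walk first, each of the three steps contributes one row sum.\<close>

lemma sum_walk_weight_le:
  fixes A :: "nat \<Rightarrow> nat \<Rightarrow> real"
  assumes nonneg: "\<And>i j. 0 \<le> A i j" and row: "\<And>i. (\<Sum>j<n. A i j) \<le> R"
  shows "(\<Sum>i<n. \<Sum>j<n. \<Sum>k<n. \<Sum>l<n. A i j * A j k * A k l) \<le> real n * R ^ 3"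
proof -
  have R: "0 \<le> R" using row[of 0] nonneg by (meson order_trans sum_nonneg)
  have "(\<Sum>i<n. \<Sum>j<n. \<Sum>k<n. \<Sum>l<n. A i j * A j k * A k l) =
      (\<Sum>i<n. \<Sum>j<n. A i j * (\<Sum>k<n. A j k * (\<Sum>l<n. A k l)))"
    by (simp add: sum_distrib_left mult.assoc)
  also have "\<dots> \<le> (\<Sum>i<n. \<Sum>j<n. A i j * (\<Sum>k<n. A j k * R))"
    by (intro sum_mono mult_left_mono row nonneg)
  also have "\<dots> = (\<Sum>i<n. \<Sum>j<n. A i j * ((\<Sum>k<n. A j k) * R))"
    by (simp add: sum_distrib_right)
  also have "\<dots> \<le> (\<Sum>i<n. \<Sum>j<n. A i j * (R * R))"
    by (intro sum_mono mult_left_mono mult_right_mono row nonneg R)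
  also have "\<dots> = (\<Sum>i<n. (\<Sum>j<n. A i j) * (R * R))"
    by (simp add: sum_distrib_right)
  also have "\<dots> \<le> (\<Sum>i<n. R * (R * R))"
    by (intro sum_mono mult_right_mono row) (simp add: R)
  finally show ?thesis by (simp add: power3_eq_cube mult.assoc)
qed

lemma exp_le_prod_one_minus:
  fixes t :: "'j \<Rightarrow> real"
  assumes "\<And>j. j \<in> J \<Longrightarrow> 0 \<le> t j \<and> t j \<le> 1 / 2"
  shows "exp (- 2 * sum t J) \<le> (\<Prod>j\<in>J. 1 - t j)"
proof (cases "finite J")
  case True
  have "exp (- 2 * t j) \<le> 1 - t j" if "j \<in> J" for j
  proof -
    have t: "0 \<le> t j" "t j \<le> 1 / 2" using assms[OF that] by auto
    have "(t j)\<^sup>2 \<le> t j * (1 / 2)"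
      unfolding power2_eq_square using t by (intro mult_left_mono) auto
    then have "- 2 * t j \<le> - t j - 2 * (t j)\<^sup>2" by linarith
    also have "\<dots> \<le> ln (1 - t j)" by (rule ln_one_minus_pos_lower_bound) (use t in auto)
    finally show ?thesis using t by (subst ln_ge_iff[symmetric]) auto
  qed
  then have "(\<Prod>j\<in>J. exp (- 2 * t j)) \<le> (\<Prod>j\<in>J. 1 - t j)"
    by (intro prod_mono) auto
  then show ?thesis using True by (simp add: exp_sum sum_distrib_left)
qed simp

text \<open>Vertices are named by their positions on the path, and the random edges off the path must not
  complete a four-cycle. It suffices to exclude the cycles \<open>(i, j, k, l)\<close> whose closing edge from \<open>l\<close> to \<open>i\<close> is off the path: every four-cycle has an edge off the path and
  can be rotated to close there. This extracts a factor \<open>p\<close> and leaves a three-step walk.\<close>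

lemma four_cycle_free_weight_ge:
  fixes p R :: real
  assumes vs: "distinct vs" "set vs = {1..n}" "length vs = n"
    and sub: "edges (path_graph vs) \<subseteq> edges (complete_graph n)"
    and p: "0 \<le> p" "p \<le> 1 / 2" and R: "real n * p + 2 \<le> R"
  shows "p ^ n * exp (- 2 * (real n * p * R ^ 3)) \<le>
    (\<Sum>G | G \<subseteq> edges (complete_graph n) \<and> edges (path_graph vs) \<subseteq> G \<and>
        \<not> contains_cycle 4 ({1..n}, G). bernoulli_weight p (edges (complete_graph n)) G)"
proof -
  define E where "E = edges (complete_graph n)"
  define B where "B = edges (path_graph vs)"
  define A where "A = position_weight p"
  define e where "e i j = {vs ! i, vs ! j}" for i j
  define C where "C = (\<lambda>(i, j, k, l). {e i j, e j k, e k l, e l i})"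
  define J where "J = {(i, j, k, l). i < n \<and> j < n \<and> k < n \<and> l < n \<and>
    distinct [i, j, k, l] \<and> e l i \<notin> B}"
  define t where "t x = p ^ card (C x - B)" for x

  have finE: "finite E"
  proof -
    have "E \<subseteq> Pow {1..n}" unfolding E_def complete_graph_def by auto
    then show ?thesis using finite_subset by blast
  qed
  have BE: "B \<subseteq> E" using sub by (simp add: B_def E_def)
  have finJ: "finite J"
    by (rule finite_subset[of _ "{..<n} \<times> {..<n} \<times> {..<n} \<times> {..<n}"]) (auto simp: J_def)
  have nth_in: "vs ! i \<in> {1..n}" if "i < n" for i
    using that vs nth_mem[of i vs] by auto
  have nth_eq: "vs ! i = vs ! j \<longleftrightarrow> i = j" if "i < n" "j < n" for i j
    using that vs by (simp add: nth_eq_iff_index_eq)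
  have e_in_E: "e i j \<in> E" if "i < n" "j < n" "i \<noteq> j" for i j
  proof -
    have "vs ! i \<noteq> vs ! j" using that nth_eq by blast
    then show ?thesis
      using nth_in[OF that(1)] nth_in[OF that(2)] unfolding E_def e_def complete_graph_def by auto
  qed
  have A_e: "A i j = (if e i j \<in> B then 1 else p)" if "i < n" "j < n" for i j
    using that vs edge_path_graph_iff[of vs i j] by (simp add: A_def B_def e_def position_weight_def)

  have card_B: "card B \<le> n"
  proof -
    have "B \<subseteq> (\<lambda>i. {vs ! i, vs ! Suc i}) ` {..<n}"
      by (auto simp: B_def path_graph_def vs)
    from surj_card_le[OF finite_lessThan this] show ?thesis by simp
  qed

  have t_bounds: "0 \<le> t x \<and> t x \<le> 1 / 2" if "x \<in> J" for x
  proof -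
    have "C x - B \<noteq> {}" "finite (C x - B)" using that by (auto simp: J_def C_def)
    then have "1 \<le> card (C x - B)" by (simp add: Suc_le_eq card_gt_0_iff)
    then have "p ^ card (C x - B) \<le> p ^ 1" using p by (intro power_decreasing) auto
    then show ?thesis using p by (simp add: t_def)
  qed

  have t_eq: "t (i, j, k, l) = p * (A i j * A j k * A k l)" if "(i, j, k, l) \<in> J" for i j k l
  proof -
    have ix: "i < n" "j < n" "k < n" "l < n" "distinct [i, j, k, l]" "e l i \<notin> B"
      using that by (auto simp: J_def)
    have weight: "p ^ card (D - B) = (\<Prod>d\<in>D. if d \<in> B then 1 else p)" if "finite D" for D
    proof -
      have "(\<Prod>d\<in>D. if d \<in> B then 1 else p) = (\<Prod>d\<in>D - B. p)"
        using that by (intro prod.mono_neutral_cong_right) auto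
      then show ?thesis by simp
    qed
    have "distinct [e i j, e j k, e k l, e l i]"
      using ix by (auto simp: e_def doubleton_eq_iff nth_eq)
    then have "t (i, j, k, l) = A i j * A j k * A k l * A l i"
      using ix by (simp add: t_def C_def weight A_e)
    then show ?thesis using ix by (simp add: A_e)
  qed

  have sum_t: "sum t J \<le> real n * p * R ^ 3"
  proof -
    define X where "X = {..<n} \<times> {..<n} \<times> {..<n} \<times> {..<n}"
    have A_nonneg: "0 \<le> A i j" for i j using p by (simp add: A_def position_weight_def)
    have "sum t J = (\<Sum>(i, j, k, l)\<in>J. p * (A i j * A j k * A k l))"
      by (intro sum.cong) (auto simp: t_eq)
    also have "\<dots> \<le> (\<Sum>(i, j, k, l)\<in>X. p * (A i j * A j k * A k l))"
      using A_nonneg p by (intro sum_mono2) (auto simp: X_def J_def)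
    also have "\<dots> = p * (\<Sum>i<n. \<Sum>j<n. \<Sum>k<n. \<Sum>l<n. A i j * A j k * A k l)"
      by (simp only: X_def sum_distrib_left sum.cartesian_product) (simp add: case_prod_unfold)
    also have "\<dots> \<le> p * (real n * R ^ 3)"
    proof (intro mult_left_mono sum_walk_weight_le A_nonneg p)
      show "(\<Sum>j<n. A i j) \<le> R" for i
        using sum_position_weight_le[OF p(1), of i n] R unfolding A_def by linarith
    qed
    finally show ?thesis by (simp add: mult_ac)
  qed

  have cycle_free: "\<not> contains_cycle 4 ({1..n}, B \<union> H)"
    if avoid: "\<forall>x\<in>J. \<not> C x - B \<subseteq> H" for H
  proof
    assume "contains_cycle 4 ({1..n}, B \<union> H)"
    then obtain a b c d where cyc: "distinct [a, b, c, d]" "{a, b, c, d} \<subseteq> set vs"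
      "{{a, b}, {b, c}, {c, d}, {d, a}} \<subseteq> B \<union> H"
      by (rule contains_four_cycleE) (simp add: vs(2))
    from cyc(2) obtain i j k l where ix: "i < n" "j < n" "k < n" "l < n"
      "a = vs ! i" "b = vs ! j" "c = vs ! k" "d = vs ! l"
      using vs(3) by (auto simp: in_set_conv_nth)
    have dist: "distinct [i, j, k, l]" using cyc(1) ix by auto
    have C_sub: "C (i, j, k, l) \<subseteq> B \<union> H"
      using cyc(3) by (simp add: C_def e_def ix)
    have rotate: "C (j, k, l, i) = C (i, j, k, l)" "C (k, l, i, j) = C (i, j, k, l)"
      "C (l, i, j, k) = C (i, j, k, l)"
      by (auto simp: C_def)
    have "\<not> {e i j, e j k, e k l, e l i} \<subseteq> B"
    proof
      assume "{e i j, e j k, e k l, e l i} \<subseteq> B"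
      then have "contains_cycle 4 (path_graph vs)"
        using cyc(1,2) ix
        by (intro contains_four_cycleI[of a b c d]) (simp_all add: B_def e_def)
      then show False using path_graph_no_four_cycle[OF vs(1)] by blast
    qed
    then have "(i, j, k, l) \<in> J \<or> (j, k, l, i) \<in> J \<or> (k, l, i, j) \<in> J \<or> (l, i, j, k) \<in> J"
      using ix dist unfolding J_def by auto
    then obtain x where "x \<in> J" "C x = C (i, j, k, l)" using rotate by blast
    with C_sub avoid show False by blast
  qed

  \<comment> \<open>The path has \<open>n - 1\<close> edges; the cruder \<open>n\<close> costs only a factor \<open>p\<close>.\<close>
  have "p ^ n * exp (- 2 * (real n * p * R ^ 3)) \<le> p ^ card B * exp (- 2 * sum t J)"
    using sum_t card_B p by (intro mult_mono power_decreasing) auto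
  also have "\<dots> \<le> p ^ card B * (\<Prod>x\<in>J. 1 - t x)"
    using exp_le_prod_one_minus[of J t] t_bounds p by (intro mult_left_mono) auto
  also have "\<dots> \<le> p ^ card B *
      (\<Sum>H\<in>Pow (E - B). bernoulli_weight p (E - B) H * of_bool (\<forall>x\<in>J. \<not> C x - B \<subseteq> H))"
  proof (rule mult_left_mono)
    have "C x - B \<subseteq> E - B" if "x \<in> J" for x
      using that by (auto simp: J_def C_def intro: e_in_E)
    then show "(\<Prod>x\<in>J. 1 - t x) \<le>
      (\<Sum>H\<in>Pow (E - B). bernoulli_weight p (E - B) H * of_bool (\<forall>x\<in>J. \<not> C x - B \<subseteq> H))"
      unfolding t_def using finE finJ p by (intro avoidance_correlation) auto
  qed (use p in simp)
  also have "\<dots> \<le> p ^ card B *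
      (\<Sum>H\<in>Pow (E - B). bernoulli_weight p (E - B) H *
        of_bool (\<not> contains_cycle 4 ({1..n}, B \<union> H)))"
    using p cycle_free
    by (intro mult_left_mono sum_mono bernoulli_weight_nonneg) (auto simp: of_bool_def)
  also have "\<dots> = (\<Sum>G | G \<subseteq> E \<and> B \<subseteq> G \<and> \<not> contains_cycle 4 ({1..n}, G). bernoulli_weight p E G)"
    by (rule sum_bernoulli_weight_superset[OF finE BE, symmetric])
  finally show ?thesis unfolding E_def B_def .
qed

section \<open>The upper bound\<close>

text \<open>The events for different members of \<open>F\<close> are disjoint, because a graph containing two of them
  contains the four-cycle in their union; so their probabilities sum to at most \<open>1\<close>.\<close>

lemma card_cycle_family_le:
  fixes p R :: real
  assumes F: "F \<in> cycle_families n 4"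
    and p: "0 \<le> p" "p \<le> 1 / 2" and R: "real n * p + 2 \<le> R"
  shows "real (card F) * (p ^ n * exp (- 2 * (real n * p * R ^ 3))) \<le> 1"
proof -
  define E where "E = edges (complete_graph n)"
  define W where "W P = {G. G \<subseteq> E \<and> edges P \<subseteq> G \<and> \<not> contains_cycle 4 ({1..n}, G)}" for P
  have finE: "finite E"
  proof -
    have "E \<subseteq> Pow {1..n}" unfolding E_def complete_graph_def by auto
    then show ?thesis using finite_subset by blast
  qed
  have ham: "hamilton_path (complete_graph n) P" if "P \<in> F" for P
    using F that by (auto simp: cycle_families_def)
  have verts_eq: "verts P = {1..n}" if "P \<in> F" for P
    using hamilton_path_complete_graphE[OF ham[OF that]] by (metis verts_path_graph)
  have disj: "W P \<inter> W Q = {}" if "P \<in> F" "Q \<in> F" "P \<noteq> Q" for P Q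
  proof -
    have "contains_cycle 4 (graph_union P Q)"
      using F that by (auto simp: cycle_families_def pairwise_def)
    moreover have "verts (graph_union P Q) \<subseteq> {1..n}"
      using that verts_eq by (simp add: graph_union_def)
    ultimately have "contains_cycle 4 ({1..n}, G)" if "edges P \<subseteq> G" "edges Q \<subseteq> G" for G
      using that by (elim contains_four_cycle_mono) (auto simp: graph_union_def)
    then show ?thesis by (auto simp: W_def)
  qed
  have lower: "p ^ n * exp (- 2 * (real n * p * R ^ 3)) \<le> (\<Sum>G\<in>W P. bernoulli_weight p E G)"
    if "P \<in> F" for P
  proof -
    obtain vs where vs: "distinct vs" "set vs = {1..n}" "length vs = n" "P = path_graph vs"
      "edges P \<subseteq> edges (complete_graph n)"
      by (rule hamilton_path_complete_graphE[OF ham[OF \<open>P \<in> F\<close>]])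
    show ?thesis
      using four_cycle_free_weight_ge[OF vs(1-3) vs(5)[unfolded vs(4)] p R]
      by (simp only: W_def E_def vs(4))
  qed
  have "real (card F) * (p ^ n * exp (- 2 * (real n * p * R ^ 3))) \<le>
      (\<Sum>P\<in>F. \<Sum>G\<in>W P. bernoulli_weight p E G)"
    using sum_mono[OF lower, of F "\<lambda>P. P"] by simp
  also have "\<dots> = (\<Sum>G\<in>(\<Union>P\<in>F. W P). bernoulli_weight p E G)"
    using cycle_family_finite[OF F] finE disj
    by (intro sum.UNION_disjoint[symmetric]) (auto simp: W_def)
  also have "\<dots> \<le> (\<Sum>G\<in>Pow E. bernoulli_weight p E G)"
    using finE p by (intro sum_mono2 bernoulli_weight_nonneg) (auto simp: W_def)
  also have "\<dots> = 1" by (rule sum_bernoulli_weight[OF finE])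
  finally show ?thesis .
qed

text \<open>The choice of \<open>p\<close> balances the two losses: it is the largest order of magnitude for which the
  expected number of four-cycles, about \<open>(n * p) ^ 4\<close>, stays linear in \<open>n\<close>, so that avoiding them
  costs only an exponential factor. The factor \<open>1 / 2\<close> makes \<open>p \<le> 1 / 2\<close> hold for all \<open>n \<ge> 1\<close>. The
  constant \<open>28\<close> is \<open>27\<close> from the exponential plus \<open>1\<close> for absorbing \<open>2 ^ n\<close>.\<close>

lemma M_le_powr:
  assumes "2 \<le> n"
  shows "real (M n 4) \<le> real n powr (3 * real n / 4 + 28 * (real n / ln (real n)))"
proof -
  define p where "p = real n powr (- 3 / 4) / 2"
  define R where "R = 3 * real n powr (1 / 4)"
  have n: "1 < real n" using assms by simp
  have p: "0 < p" "p \<le> 1 / 2"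
    using n powr_mono[of "- 3 / 4" 0 "real n"] by (auto simp: p_def)
  have root_ge_1: "1 \<le> real n powr (1 / 4)"
    using n by (simp add: ge_one_powr_ge_zero)
  have np: "real n * real n powr (- 3 / 4) = real n powr (1 / 4)"
    using n powr_add[of "real n" 1 "- 3 / 4"] by simp
  have R: "real n * p + 2 \<le> R"
    using np root_ge_1 by (simp add: p_def R_def)
  have cube: "(real n powr (1 / 4)) ^ 3 = real n powr (3 / 4)"
    using n by (simp flip: powr_realpow add: powr_powr)
  have "p * R ^ 3 = 27 / 2 * (real n powr (- 3 / 4) * real n powr (3 / 4))"
    by (simp add: p_def R_def power_mult_distrib cube)
  also have "\<dots> = 27 / 2" using n by (simp flip: powr_add)
  finally have pR: "real n * p * R ^ 3 = 27 / 2 * real n" by (simp add: mult.assoc)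
  obtain F where F: "F \<in> cycle_families n 4" "card F = M n 4"
    using M_attained by blast
  have "real (M n 4) * (p ^ n * exp (- 27 * real n)) \<le> 1"
    using card_cycle_family_le[OF F(1) _ p(2) R] p(1) F(2) pR by simp
  then have "real (M n 4) \<le> 1 / (p ^ n * exp (- 27 * real n))"
    using p(1) by (simp add: pos_le_divide_eq)
  also have "\<dots> = 2 ^ n * exp (27 * real n) * (1 / (real n powr (- 3 / 4)) ^ n)"
    by (simp add: p_def power_divide exp_minus field_simps)
  also have "1 / (real n powr (- 3 / 4)) ^ n = real n powr (3 * real n / 4)"
  proof -
    have "(real n powr (- 3 / 4)) ^ n = real n powr (- 3 / 4 * real n)"
      using n by (simp flip: powr_realpow add: powr_powr)
    then show ?thesis by (simp add: powr_minus field_simps)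
  qed
  also have "2 ^ n * exp (27 * real n) * real n powr (3 * real n / 4) \<le>
      exp (28 * real n) * real n powr (3 * real n / 4)"
  proof -
    have "(2::real) \<le> exp 1" using exp_ge_add_one_self[of "1::real"] by simp
    then have "(2::real) ^ n \<le> exp 1 ^ n" by (intro power_mono) auto
    also have "\<dots> = exp (real n)" by (simp flip: exp_of_nat_mult)
    finally have "2 ^ n * exp (27 * real n) \<le> exp (real n) * exp (27 * real n)"
      by (intro mult_right_mono) auto
    then show ?thesis by (intro mult_right_mono) (auto simp flip: exp_add)
  qed
  also have "exp (28 * real n) = real n powr (28 * (real n / ln (real n)))"
    using n by (simp add: powr_def)
  also have "\<dots> * real n powr (3 * real n / 4) =
      real n powr (3 * real n / 4 + 28 * (real n / ln (real n)))"
    by (simp add: powr_add)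
  finally show ?thesis .
qed

theorem theorem2:
  shows "(\<forall>n::nat. 1 \<le> n \<longrightarrow> fact (n div 2) \<le> M n 4) \<and>
    (\<exists>c::real. 0 < c \<and>
      (\<forall>n::nat. 2 \<le> n \<longrightarrow>
        real (M n 4) \<le> real n powr (3 * real n / 4 + c * (real n / ln (real n)))))"
  using fact_half_le_M M_le_powr by (intro conjI exI[of _ 28]) auto

end
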